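(* Let $\mathbb F\in\{\mathbb R,\mathbb C\}$ and let $L\in M_{2n-1}(\mathbb F)$. Then $L(\mathcal R)\subseteq\mathcal R$ if and only if one of the following holds: (a) $L^\top$ is of one of the following forms: (i) $L^\top=\gamma V_{2n-1}(\alpha)D_{2n-1}(r)$, (ii) $L^\top=\gamma V_{2n-1}(\alpha)F_{2n-1}D_{2n-1}(r)$, (iii) $L^\top=\gamma W_{2n-1}(\alpha,\beta)D_{2n-1}(r)$, for some $\gamma,r,\alpha,\beta\in\mathbb F$ with $\gamma r\neq0$ and $\alpha\neq\beta$. (b) $\mathbb F=\mathbb R$ and $L=h\,[c_1,\dots,c_{2n-1}]$ for some $h\in\mathcal R$ and $c_1,\dots,c_{2n-1}\in\mathbb R$ such that $c_1+c_2x+\cdots+c_{2n-1}x^{2n-2}\neq0$ for every $x\in\mathbb R$.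
   Context: Let $h(\xi)=[1,\xi,\dots,\xi^{2n-2}]^\top\in\mathbb F^{2n-1}$ for $\xi\in\mathbb F$ (with $0^0=1$) and $h(\infty)=[0,\dots,0,1]^\top\in\mathbb F^{2n-1}$. Let $\mathcal R=\{\mu h(\xi):\mu\in\mathbb F\setminus\{0\},\ \xi\in\mathbb F\cup\{\infty\}\}$. $L(\mathcal R)\subseteq\mathcal R$ means $Lh\in\mathcal R$ for all $h\in\mathcal R$. For a positive integer $m$ (used with $m=2n-1$): $\mathbf e_1$ is the first column of $I_m$; $Z_m$ is the $m\times m$ lower shift matrix (ones on the first subdiagonal, zeros elsewhere); $\mathcal J_\alpha=\alpha I_m+Z_m$; $F_m$ is the anti-diagonal permutation matrix (ones on the anti-diagonal, zeros elsewhere); $D_m(r)=\mathrm{diag}(1,r,\dots,r^{m-1})$; $V_m(\alpha)=[\mathbf e_1\ \mathcal J_\alpha\mathbf e_1\ \cdots\ \mathcal J_\alpha^{m-1}\mathbf e_1]$, i.e. the upper triangular matrix with $(i,j)$ entry $\binom{j-1}{i-1}\alpha^{j-i}$ for $i\le j$; $W_m(\alpha,\beta)$ is the $m\times m$ matrix whose $j$-th column is $\mathcal J_\beta^{m-j}\mathcal J_\alpha^{j-1}\mathbf e_1$.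
   Formalization: In (b) the condition c_{2n-1} ≠ 0 is added; as printed the "if" direction fails for n ≥ 2, since c = (1,0,…,0) gives the nonvanishing polynomial 1 but L h(∞) = c_{2n-1} h = 0, which is not in R. *)

theory Defs
  imports Complex_Main "Jordan_Normal_Form.Matrix"
begin

text \<open>Rows and columns are numbered from 0, so the customary 1-based index \<open>j\<close> is \<open>j - 1\<close> below.\<close>

text \<open>\<open>None\<close> is the point at infinity, \<open>Some x\<close> the finite parameter \<open>x\<close>.\<close>

definition hvec :: "nat \<Rightarrow> 'a::field option \<Rightarrow> 'a vec" where
  "hvec n \<xi> = (case \<xi> of
       Some x \<Rightarrow> vec (2 * n - 1) (\<lambda>i. x ^ i)
     | None \<Rightarrow> unit_vec (2 * n - 1) (2 * n - 2))"

definition Rset :: "nat \<Rightarrow> 'a::field vec set" where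
  "Rset n = {\<mu> \<cdot>\<^sub>v hvec n \<xi> | \<mu> \<xi>. \<mu> \<noteq> 0}"

definition preserves_R :: "nat \<Rightarrow> 'a::field mat \<Rightarrow> bool" where
  "preserves_R n L \<longleftrightarrow> (\<forall>h \<in> Rset n. L *\<^sub>v h \<in> Rset n)"

definition Zmat :: "nat \<Rightarrow> 'a::field mat" where
  "Zmat m = mat m m (\<lambda>(i, j). if i = j + 1 then 1 else 0)"

definition Jmat :: "nat \<Rightarrow> 'a::field \<Rightarrow> 'a mat" where
  "Jmat m \<alpha> = \<alpha> \<cdot>\<^sub>m 1\<^sub>m m + Zmat m"

definition Fmat :: "nat \<Rightarrow> 'a::field mat" where
  "Fmat m = mat m m (\<lambda>(i, j). if i + j + 1 = m then 1 else 0)"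

definition Dmat :: "nat \<Rightarrow> 'a::field \<Rightarrow> 'a mat" where
  "Dmat m r = mat_diag m (\<lambda>i. r ^ i)"

definition Vmat :: "nat \<Rightarrow> 'a::field \<Rightarrow> 'a mat" where
  "Vmat m \<alpha> = mat_of_cols m (map (\<lambda>j. (Jmat m \<alpha> ^\<^sub>m j) *\<^sub>v unit_vec m 0) [0..<m])"

definition Wmat :: "nat \<Rightarrow> 'a::field \<Rightarrow> 'a \<Rightarrow> 'a mat" where
  "Wmat m \<alpha> \<beta> = mat_of_cols m
     (map (\<lambda>j. (Jmat m \<beta> ^\<^sub>m (m - 1 - j) * Jmat m \<alpha> ^\<^sub>m j) *\<^sub>v unit_vec m 0) [0..<m])"

definition standard_form :: "nat \<Rightarrow> 'a::field mat \<Rightarrow> bool" where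
  "standard_form n L \<longleftrightarrow>
     (\<exists>\<gamma> r \<alpha> \<beta>. \<gamma> * r \<noteq> 0 \<and> \<alpha> \<noteq> \<beta> \<and>
        (transpose_mat L = \<gamma> \<cdot>\<^sub>m (Vmat (2 * n - 1) \<alpha> * Dmat (2 * n - 1) r) \<or>
         transpose_mat L = \<gamma> \<cdot>\<^sub>m (Vmat (2 * n - 1) \<alpha> * Fmat (2 * n - 1) * Dmat (2 * n - 1) r) \<or>
         transpose_mat L = \<gamma> \<cdot>\<^sub>m (Wmat (2 * n - 1) \<alpha> \<beta> * Dmat (2 * n - 1) r)))"

definition outer :: "'a::field vec \<Rightarrow> 'a vec \<Rightarrow> 'a mat" where
  "outer h c = mat_of_cols (dim_vec h) [h] * mat_of_rows (dim_vec c) [c]"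

text \<open>
  \<open>outer h c *\<^sub>v hvec n \<xi>\<close> is \<open>h\<close> times the value of the polynomial with
  coefficients \<open>c\<close> at a finite \<open>\<xi>\<close>, and \<open>h\<close> times its coefficient of degree \<open>2 * n - 2\<close>
  at infinity. Since 0 is not in \<open>Rset n\<close>, both factors have to be nonzero: the following
  lemma shows with the constant polynomial 1 that having no zero among the finite real \<open>x\<close>
  does not suffice.
\<close>

lemma outer_not_preserves_R:
  fixes h :: "real vec"
  assumes n: "n \<ge> 2" and h: "h \<in> Rset n"
  defines "c \<equiv> unit_vec (2 * n - 1) 0"
  shows "\<forall>x::real. (\<Sum>i<2 * n - 1. c $ i * x ^ i) \<noteq> 0"
    and "\<not> preserves_R n (outer h c)"
proof -
  have "(\<Sum>i<2 * n - 1. c $ i * x ^ i) = (\<Sum>i<2 * n - 1. if i = 0 then 1 else 0)" for x :: real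
    using n by (intro sum.cong) (auto simp: c_def unit_vec_def)
  then show "\<forall>x::real. (\<Sum>i<2 * n - 1. c $ i * x ^ i) \<noteq> 0"
    using n by simp
  have dim: "dim_vec h = 2 * n - 1"
    using h by (auto simp: Rset_def hvec_def split: option.splits)
  have "outer h c *\<^sub>v hvec n None =
      mat_of_cols (2 * n - 1) [h] *\<^sub>v (mat_of_rows (2 * n - 1) [c] *\<^sub>v hvec n None)"
    unfolding outer_def dim
    by (subst assoc_mult_mat_vec[of _ "2*n-1" 1 _ "2*n-1"]) (auto simp: hvec_def c_def)
  also have "mat_of_rows (2 * n - 1) [c] *\<^sub>v hvec n None = 0\<^sub>v 1"
    using n by (intro eq_vecI) (auto simp: hvec_def c_def)
  also have "mat_of_cols (2 * n - 1) [h] *\<^sub>v 0\<^sub>v 1 = 0\<^sub>v (2 * n - 1)"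
    by (intro eq_vecI) (auto simp: scalar_prod_def)
  finally have eq: "outer h c *\<^sub>v hvec n None = 0\<^sub>v (2 * n - 1)" .
  have nz: "(0\<^sub>v (2 * n - 1) :: real vec) \<notin> Rset n"
  proof
    assume "(0\<^sub>v (2 * n - 1) :: real vec) \<in> Rset n"
    then obtain \<mu> \<xi> where \<mu>: "\<mu> \<noteq> 0" and z: "(0\<^sub>v (2 * n - 1) :: real vec) = \<mu> \<cdot>\<^sub>v hvec n \<xi>"
      by (auto simp: Rset_def)
    show False
    proof (cases \<xi>)
      case None
      then show False using arg_cong[OF z, of "\<lambda>v. v $ (2 * n - 2)"] n \<mu> by (simp add: hvec_def)
    next
      case (Some x)
      then show False using arg_cong[OF z, of "\<lambda>v. v $ 0"] n \<mu> by (simp add: hvec_def)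
    qed
  qed
  have "hvec n None \<in> (Rset n :: real vec set)"
    unfolding Rset_def by (rule CollectI, rule exI[of _ 1], rule exI[of _ None]) auto
  with eq nz show "\<not> preserves_R n (outer h c)"
    unfolding preserves_R_def by metis
qed

end

theory Submission
  imports Defs
    "HOL-Computational_Algebra.Polynomial_Factorial"
    "HOL-Computational_Algebra.Field_as_Ring"
    "HOL-Computational_Algebra.Fundamental_Theorem_Algebra"
begin

text \<open>
  Reading row \<open>i\<close> of \<open>L\<close> as a polynomial \<open>P i\<close> of degree at most \<open>d = 2 * n - 2\<close>, the vector
  \<open>L *\<^sub>v hvec n (Some x)\<close> has the entries \<open>P i\<close> evaluated at \<open>x\<close>. Membership in \<open>Rset n\<close>
  makes these entries a geometric progression for every \<open>x\<close>, hence \<open>P i = g * a ^ i * b ^ (d - i)\<close>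
  for polynomials \<open>g\<close>, \<open>a\<close>, \<open>b\<close> with \<open>a\<close> and \<open>b\<close> coprime. If \<open>a\<close> or \<open>b\<close> is not constant, the
  degree bound leaves only a constant \<open>g\<close> and linear \<open>a\<close> and \<open>b\<close>: \<open>L\<close> is induced by the
  Moebius transformation \<open>a / b\<close>, and the three standard forms correspond to \<open>b\<close> constant,
  \<open>a\<close> constant and neither constant. If both are constant, \<open>L\<close> has rank one and \<open>g\<close> may
  not vanish on the projective line, which is impossible over the complex numbers unless \<open>d = 0\<close>.
\<close>

section \<open>Coefficients at a formal degree\<close>

text \<open>In every other term of the convolution one factor lies above its degree bound. The
  bounds need not be attained, so the rule also covers linear factors that degenerate to
  constants.\<close>

lemma coeff_mult_add:
  fixes p q :: "'a::comm_semiring_0 poly"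
  assumes "degree p \<le> i" "degree q \<le> j"
  shows "coeff (p * q) (i + j) = coeff p i * coeff q j"
proof -
  have "coeff p k * coeff q (i + j - k) = (if k = i then coeff p i * coeff q j else 0)"
    if "k \<le> i + j" for k
  proof (cases k i rule: linorder_cases)
    case less
    with that assms have "coeff q (i + j - k) = 0" by (intro coeff_eq_0) linarith
    with less show ?thesis by simp
  next
    case greater
    with assms have "coeff p k = 0" by (intro coeff_eq_0) linarith
    with greater show ?thesis by simp
  qed simp
  then have "coeff (p * q) (i + j) = (\<Sum>k\<le>i + j. if k = i then coeff p i * coeff q j else 0)"
    unfolding coeff_mult by (intro sum.cong) auto
  then show ?thesis by simp
qed

lemma degree_linear_power_le: "degree ([:a, b:] ^ k) \<le> k"
  by (rule order_trans[OF degree_power_le]) simp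

lemma coeff_linear_power_top: "coeff ([:a, b:] ^ k) k = (b ^ k :: 'a::comm_semiring_1)"
proof (induction k)
  case (Suc k)
  have "coeff ([:a, b:] * [:a, b:] ^ k) (1 + k) = coeff [:a, b:] 1 * coeff ([:a, b:] ^ k) k"
    by (rule coeff_mult_add) (use degree_linear_power_le in auto)
  with Suc show ?case by simp
qed simp

section \<open>Homogeneous coordinates for \<open>Rset\<close>\<close>

text \<open>The pair (s : t) is a point of the projective line with parameter s / t, and t = 0 is
  infinity, where \<open>0 ^ 0 = 1\<close> keeps only the last entry. This form treats finite and
  infinite parameters alike.\<close>

lemma mem_Rset_iff:
  fixes v :: "'a::field vec"
  assumes "n \<ge> 1"
  shows "v \<in> Rset n \<longleftrightarrow> (\<exists>c s t. c \<noteq> 0 \<and> (s \<noteq> 0 \<or> t \<noteq> 0) \<and>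
    v = vec (2 * n - 1) (\<lambda>i. c * s ^ i * t ^ (2 * n - 2 - i)))"
proof
  assume "v \<in> Rset n"
  then obtain \<mu> \<xi> where v: "\<mu> \<noteq> 0" "v = \<mu> \<cdot>\<^sub>v hvec n \<xi>" by (auto simp: Rset_def)
  show "\<exists>c s t. c \<noteq> 0 \<and> (s \<noteq> 0 \<or> t \<noteq> 0) \<and>
    v = vec (2 * n - 1) (\<lambda>i. c * s ^ i * t ^ (2 * n - 2 - i))"
  proof (cases \<xi>)
    case None
    have "v = vec (2 * n - 1) (\<lambda>i. \<mu> * 1 ^ i * 0 ^ (2 * n - 2 - i))"
      using v None by (intro eq_vecI) (auto simp: hvec_def unit_vec_def power_0_left)
    with v show ?thesis by (metis zero_neq_one)
  next
    case (Some x)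
    have "v = vec (2 * n - 1) (\<lambda>i. \<mu> * x ^ i * 1 ^ (2 * n - 2 - i))"
      using v Some by (intro eq_vecI) (auto simp: hvec_def)
    with v show ?thesis by (metis zero_neq_one)
  qed
next
  assume "\<exists>c s t. c \<noteq> 0 \<and> (s \<noteq> 0 \<or> t \<noteq> 0) \<and>
    v = vec (2 * n - 1) (\<lambda>i. c * s ^ i * t ^ (2 * n - 2 - i))"
  then obtain c s t where c: "c \<noteq> 0" and st: "s \<noteq> 0 \<or> t \<noteq> 0"
    and v: "v = vec (2 * n - 1) (\<lambda>i. c * s ^ i * t ^ (2 * n - 2 - i))" by blast
  show "v \<in> Rset n"
  proof (cases "t = 0")
    case True
    have "v = (c * s ^ (2 * n - 2)) \<cdot>\<^sub>v hvec n None"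
      using v True by (intro eq_vecI) (auto simp: hvec_def unit_vec_def power_0_left)
    with c st True show ?thesis unfolding Rset_def by auto
  next
    case False
    have "s ^ i * t ^ (2 * n - 2 - i) = t ^ (2 * n - 2) * (s / t) ^ i" if "i < 2 * n - 1" for i
    proof -
      from that have "t ^ (2 * n - 2) = t ^ i * t ^ (2 * n - 2 - i)"
        by (simp flip: power_add)
      with False show ?thesis by (simp add: power_divide)
    qed
    then have "v = (c * t ^ (2 * n - 2)) \<cdot>\<^sub>v hvec n (Some (s / t))"
      using v by (intro eq_vecI) (auto simp: hvec_def mult.assoc)
    with c False show ?thesis unfolding Rset_def by auto
  qed
qed

lemma hvec_in_Rset: "hvec n \<xi> \<in> Rset n"
  unfolding Rset_def by (rule CollectI, rule exI[of _ 1], rule exI[of _ \<xi>]) auto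

lemma dim_hvec [simp]: "dim_vec (hvec n \<xi>) = 2 * n - 1"
  by (simp add: hvec_def split: option.splits)

lemma smult_in_Rset:
  assumes "h \<in> Rset n" "k \<noteq> 0"
  shows "k \<cdot>\<^sub>v h \<in> Rset n"
proof -
  from assms(1) obtain \<mu> \<xi> where "\<mu> \<noteq> 0" "h = \<mu> \<cdot>\<^sub>v hvec n \<xi>" by (auto simp: Rset_def)
  with assms(2) have "k * \<mu> \<noteq> 0" "k \<cdot>\<^sub>v h = (k * \<mu>) \<cdot>\<^sub>v hvec n \<xi>"
    by (auto simp: smult_smult_assoc)
  then show ?thesis unfolding Rset_def by blast
qed

lemma zero_not_in_Rset:
  assumes "n \<ge> 1"
  shows "(0\<^sub>v (2 * n - 1) :: 'a::field vec) \<notin> Rset n"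
proof
  assume "(0\<^sub>v (2 * n - 1) :: 'a vec) \<in> Rset n"
  then obtain c s t :: 'a where c: "c \<noteq> 0" "s \<noteq> 0 \<or> t \<noteq> 0"
    and v: "0\<^sub>v (2 * n - 1) = vec (2 * n - 1) (\<lambda>i. c * s ^ i * t ^ (2 * n - 2 - i))"
    unfolding mem_Rset_iff[OF assms] by blast
  have "c * s ^ i * t ^ (2 * n - 2 - i) = 0" if "i < 2 * n - 1" for i
    using arg_cong[OF v, of "\<lambda>w. w $ i"] that by simp
  \<comment> \<open>The outer entries are c * t ^ (2 * n - 2) and c * s ^ (2 * n - 2), which cannot
    both vanish.\<close>
  from this[of 0] this[of "2 * n - 2"] c assms show False by auto
qed

lemma preserves_R_iff_hvec:
  fixes L :: "'a::field mat"
  assumes "L \<in> carrier_mat (2 * n - 1) (2 * n - 1)"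
  shows "preserves_R n L \<longleftrightarrow> (\<forall>\<xi>. L *\<^sub>v hvec n \<xi> \<in> Rset n)"
proof
  assume "preserves_R n L"
  then show "\<forall>\<xi>. L *\<^sub>v hvec n \<xi> \<in> Rset n"
    by (simp add: preserves_R_def hvec_in_Rset)
next
  assume *: "\<forall>\<xi>. L *\<^sub>v hvec n \<xi> \<in> Rset n"
  show "preserves_R n L"
    unfolding preserves_R_def
  proof
    fix h :: "'a vec" assume "h \<in> Rset n"
    then obtain \<mu> \<xi> where h: "\<mu> \<noteq> 0" "h = \<mu> \<cdot>\<^sub>v hvec n \<xi>" by (auto simp: Rset_def)
    have "L *\<^sub>v h = \<mu> \<cdot>\<^sub>v (L *\<^sub>v hvec n \<xi>)"
      unfolding h by (rule mult_mat_vec[OF assms]) (simp add: carrier_vecI)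
    with * h show "L *\<^sub>v h \<in> Rset n" by (simp add: smult_in_Rset)
  qed
qed

section \<open>Rows as polynomials\<close>

definition row_poly :: "'a::comm_monoid_add mat \<Rightarrow> nat \<Rightarrow> 'a poly" where
  "row_poly L i = (\<Sum>j<dim_col L. monom (L $$ (i, j)) j)"

lemma coeff_row_poly: "coeff (row_poly L i) j = (if j < dim_col L then L $$ (i, j) else 0)"
  by (simp add: row_poly_def coeff_sum)

lemma poly_row_poly:
  fixes L :: "'a::comm_semiring_1 mat"
  shows "poly (row_poly L i) x = (\<Sum>j<dim_col L. L $$ (i, j) * x ^ j)"
  by (simp add: row_poly_def poly_sum poly_monom)

lemma degree_row_poly:
  assumes "L \<in> carrier_mat m (Suc d)"
  shows "degree (row_poly L i) \<le> d"
  by (rule degree_le) (use assms in \<open>auto simp: coeff_row_poly\<close>)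

lemma row_poly_eq_iff:
  assumes "L \<in> carrier_mat m (Suc d)" "degree p \<le> d"
  shows "row_poly L i = p \<longleftrightarrow> (\<forall>j\<le>d. L $$ (i, j) = coeff p j)"
  using assms by (auto simp: poly_eq_iff coeff_row_poly less_Suc_eq_le coeff_eq_0)

lemma mult_mat_hvec_Some:
  assumes "L \<in> carrier_mat (2 * n - 1) (2 * n - 1)"
  shows "L *\<^sub>v hvec n (Some x) = vec (2 * n - 1) (\<lambda>i. poly (row_poly L i) x)"
  using assms
  by (intro eq_vecI) (auto simp: hvec_def scalar_prod_def poly_row_poly atLeast0LessThan)

text \<open>A row is a binary form of formal degree \<open>2 * n - 2\<close>; its value at infinity
  is the coefficient at that degree, even when the actual degree is smaller.\<close>

lemma mult_mat_hvec_None: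
  assumes "L \<in> carrier_mat (2 * n - 1) (2 * n - 1)" "n \<ge> 1"
  shows "L *\<^sub>v hvec n None = vec (2 * n - 1) (\<lambda>i. coeff (row_poly L i) (2 * n - 2))"
  using assms by (intro eq_vecI) (auto simp: hvec_def coeff_row_poly)

section \<open>Rank-one matrices\<close>

lemma dim_outer [simp]:
  "dim_row (outer h c) = dim_vec h" "dim_col (outer h c) = dim_vec c"
  by (simp_all add: outer_def)

lemma index_outer [simp]:
  assumes "i < dim_vec h" "j < dim_vec c"
  shows "outer h c $$ (i, j) = h $ i * c $ j"
  using assms by (simp add: outer_def scalar_prod_def mat_of_cols_def mat_of_rows_def)

lemma outer_mult_vec:
  assumes "dim_vec w = dim_vec c"
  shows "outer h c *\<^sub>v w = (c \<bullet> w) \<cdot>\<^sub>v h"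
  using assms
  by (intro eq_vecI) (auto simp: scalar_prod_def sum_distrib_left mult_ac intro!: sum.cong)

lemma dim_Rset: "h \<in> Rset n \<Longrightarrow> dim_vec h = 2 * n - 1"
  by (auto simp: Rset_def)

lemma smult_in_Rset_iff:
  assumes "n \<ge> 1" "h \<in> Rset n"
  shows "k \<cdot>\<^sub>v h \<in> Rset n \<longleftrightarrow> k \<noteq> 0"
proof -
  have "0 \<cdot>\<^sub>v h = 0\<^sub>v (2 * n - 1)" using dim_Rset[OF assms(2)] by auto
  then show ?thesis using smult_in_Rset[OF assms(2)] zero_not_in_Rset[OF assms(1)] by metis
qed

text \<open>Every \<open>hvec n \<xi>\<close> goes to a multiple of \<open>h\<close>, so only the
  scalar \<open>c \<bullet> hvec n \<xi>\<close> matters. Infinity contributes the condition on the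
  last entry of \<open>c\<close>.\<close>

lemma preserves_R_outer_iff:
  fixes c :: "'a::field vec"
  assumes n: "n \<ge> 1" and h: "h \<in> Rset n" and c: "c \<in> carrier_vec (2 * n - 1)"
  shows "preserves_R n (outer h c) \<longleftrightarrow>
    (\<forall>x. (\<Sum>i<2 * n - 1. c $ i * x ^ i) \<noteq> 0) \<and> c $ (2 * n - 2) \<noteq> 0"
proof -
  have "outer h c \<in> carrier_mat (2 * n - 1) (2 * n - 1)"
    using c dim_Rset[OF h] by (intro carrier_matI) auto
  then have "preserves_R n (outer h c) \<longleftrightarrow> (\<forall>\<xi>. c \<bullet> hvec n \<xi> \<noteq> 0)"
    using c by (simp add: preserves_R_iff_hvec outer_mult_vec smult_in_Rset_iff[OF n h])
  moreover have "c \<bullet> hvec n (Some x) = (\<Sum>i<2 * n - 1. c $ i * x ^ i)" for x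
    by (simp add: hvec_def scalar_prod_def atLeast0LessThan)
  moreover have "c \<bullet> hvec n None = c $ (2 * n - 2)"
    using n c by (simp add: hvec_def)
  ultimately show ?thesis
    by (metis option.exhaust)
qed

section \<open>The standard forms in terms of polynomials\<close>

text \<open>On coefficient vectors \<open>Jmat m \<alpha>\<close> is multiplication by x + \<alpha>,
  truncated below degree \<open>m\<close>. The shift moves coefficients only upwards, so truncation
  loses nothing and \<open>p\<close> may have any degree.\<close>

lemma Jmat_power_mult_coeff_vec:
  "(Jmat m \<alpha> ^\<^sub>m k) *\<^sub>v vec m (coeff p) = vec m (coeff ([:\<alpha>, 1:] ^ k * p))"
proof (induction k arbitrary: p)
  case 0
  show ?case by (simp add: Jmat_def Zmat_def)
next
  case (Suc k)
  have J: "Jmat m \<alpha> \<in> carrier_mat m m" by (simp add: Jmat_def Zmat_def)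
  have step: "Jmat m \<alpha> *\<^sub>v vec m (coeff p) = vec m (coeff ([:\<alpha>, 1:] * p))"
  proof (rule eq_vecI)
    fix i assume "i < dim_vec (vec m (coeff ([:\<alpha>, 1:] * p)))"
    then have i: "i < m" by simp
    have "(Jmat m \<alpha> *\<^sub>v vec m (coeff p)) $ i = (\<Sum>j<m. Jmat m \<alpha> $$ (i, j) * coeff p j)"
      using i J by (simp add: scalar_prod_def atLeast0LessThan)
    \<comment> \<open>At \<open>i = 0\<close> truncated subtraction makes \<open>i - 1\<close> equal
      to 0, hence the inner test.\<close>
    also have "\<dots> = (\<Sum>j<m. (if j = i then \<alpha> * coeff p i else 0) +
        (if j = i - 1 then if i = 0 then 0 else coeff p (i - 1) else 0))"
      using i by (intro sum.cong) (auto simp: Jmat_def Zmat_def)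
    also have "\<dots> = \<alpha> * coeff p i + (if i = 0 then 0 else coeff p (i - 1))"
      using i by (simp add: sum.distrib)
    also have "\<dots> = vec m (coeff ([:\<alpha>, 1:] * p)) $ i"
      using i by (auto simp: coeff_pCons split: nat.split)
    finally show "(Jmat m \<alpha> *\<^sub>v vec m (coeff p)) $ i = vec m (coeff ([:\<alpha>, 1:] * p)) $ i" .
  qed (simp add: Jmat_def Zmat_def)
  have "(Jmat m \<alpha> ^\<^sub>m Suc k) *\<^sub>v vec m (coeff p) =
    (Jmat m \<alpha> ^\<^sub>m k) *\<^sub>v (Jmat m \<alpha> *\<^sub>v vec m (coeff p))"
    unfolding pow_mat.simps
    by (rule assoc_mult_mat_vec) (use J in auto)
  also have "\<dots> = vec m (coeff ([:\<alpha>, 1:] ^ Suc k * p))"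
    unfolding step Suc.IH by (simp add: mult_ac del: mult_pCons_left mult_pCons_right)
  finally show ?case .
qed

lemma unit_vec_eq_coeff_vec: "unit_vec m 0 = vec m (coeff (1 :: 'a::comm_semiring_1 poly))"
  by (intro eq_vecI) (auto simp: unit_vec_def coeff_1)

lemma Vmat_eq: "Vmat m \<alpha> = mat m m (\<lambda>(i, j). coeff ([:\<alpha>, 1:] ^ j) i)"
  unfolding Vmat_def unit_vec_eq_coeff_vec Jmat_power_mult_coeff_vec
  by (intro eq_matI) (auto simp: mat_of_cols_def)

lemma Wmat_eq:
  "Wmat m \<alpha> \<beta> = mat m m (\<lambda>(i, j). coeff ([:\<alpha>, 1:] ^ j * [:\<beta>, 1:] ^ (m - 1 - j)) i)"
proof -
  have J: "Jmat m \<gamma> \<in> carrier_mat m m" for \<gamma> :: 'a by (simp add: Jmat_def Zmat_def)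
  have "(Jmat m \<beta> ^\<^sub>m (m - 1 - j) * Jmat m \<alpha> ^\<^sub>m j) *\<^sub>v unit_vec m 0 =
    vec m (coeff ([:\<beta>, 1:] ^ (m - 1 - j) * [:\<alpha>, 1:] ^ j))" for j
    unfolding unit_vec_eq_coeff_vec
    by (subst assoc_mult_mat_vec[of _ m m _ m])
      (use J in \<open>auto simp: Jmat_power_mult_coeff_vec\<close>)
  then show ?thesis
    unfolding Wmat_def
    by (intro eq_matI) (auto simp: mat_of_cols_def mult_ac)
qed

lemma index_mult_Dmat:
  assumes "A \<in> carrier_mat m m" "i < m" "j < m"
  shows "(A * Dmat m r) $$ (i, j) = A $$ (i, j) * r ^ j"
  using assms by (simp add: Dmat_def mat_diag_mult_right[of A m m])

lemma index_mult_Fmat: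
  assumes "A \<in> carrier_mat m m" "i < m" "j < m"
  shows "(A * Fmat m) $$ (i, j) = A $$ (i, m - 1 - j)"
proof -
  have "(A * Fmat m) $$ (i, j) = (\<Sum>k<m. A $$ (i, k) * Fmat m $$ (k, j))"
    using assms by (simp add: Fmat_def scalar_prod_def atLeast0LessThan)
  also have "\<dots> = (\<Sum>k<m. if k = m - 1 - j then A $$ (i, m - 1 - j) else 0)"
    using assms by (intro sum.cong) (auto simp: Fmat_def)
  also have "\<dots> = A $$ (i, m - 1 - j)" using assms by simp
  finally show ?thesis .
qed

lemma transpose_eq_smult_iff:
  fixes L :: "'a::field mat"
  assumes L: "L \<in> carrier_mat m m" and A: "A \<in> carrier_mat m m"
  shows "transpose_mat L = \<gamma> \<cdot>\<^sub>m (A * Dmat m r) \<longleftrightarrow>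
    (\<forall>i<m. \<forall>j<m. L $$ (i, j) = \<gamma> * r ^ i * A $$ (j, i))"
proof -
  have D: "Dmat m r \<in> carrier_mat m m" by (simp add: Dmat_def mat_diag_def)
  have "transpose_mat L = \<gamma> \<cdot>\<^sub>m (A * Dmat m r) \<longleftrightarrow>
    (\<forall>i<m. \<forall>j<m. transpose_mat L $$ (i, j) = (\<gamma> \<cdot>\<^sub>m (A * Dmat m r)) $$ (i, j))"
    using L A D by (auto simp: mat_eq_iff)
  also have "\<dots> \<longleftrightarrow> (\<forall>i<m. \<forall>j<m. L $$ (j, i) = \<gamma> * r ^ j * A $$ (i, j))"
  proof -
    have "(\<gamma> \<cdot>\<^sub>m (A * Dmat m r)) $$ (i, j) = \<gamma> * r ^ j * A $$ (i, j)" if "i < m" "j < m" for i j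
      using index_mult_Dmat[OF A that, of r] A D that by (simp del: index_mult_mat(1))
    then show ?thesis using L by simp
  qed
  finally show ?thesis by blast
qed

text \<open>Transposition turns column \<open>i\<close> of \<open>A\<close>, read as
  \<open>q i\<close>, into row \<open>i\<close> of \<open>L\<close>, and \<open>Dmat\<close> scales
  it by \<open>r ^ i\<close>. All three standard forms are instances.\<close>

lemma transpose_eq_iff_row_poly:
  fixes L :: "'a::field mat"
  assumes L: "L \<in> carrier_mat (Suc d) (Suc d)" and A: "A \<in> carrier_mat (Suc d) (Suc d)"
    and q: "\<And>i j. i \<le> d \<Longrightarrow> j \<le> d \<Longrightarrow> A $$ (j, i) = coeff (q i) j"
    and deg: "\<And>i. i \<le> d \<Longrightarrow> degree (q i) \<le> d"
  shows "transpose_mat L = \<gamma> \<cdot>\<^sub>m (A * Dmat (Suc d) r) \<longleftrightarrow>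
    (\<forall>i\<le>d. row_poly L i = smult (\<gamma> * r ^ i) (q i))"
proof -
  have "row_poly L i = smult (\<gamma> * r ^ i) (q i) \<longleftrightarrow>
      (\<forall>j\<le>d. L $$ (i, j) = \<gamma> * r ^ i * A $$ (j, i))" if "i \<le> d" for i
    using deg[OF that] q[OF that]
    by (subst row_poly_eq_iff[OF L]) (auto intro: order_trans[OF degree_smult_le])
  then show ?thesis
    by (auto simp: transpose_eq_smult_iff[OF L A] less_Suc_eq_le)
qed

section \<open>Matrices induced by Moebius transformations\<close>

text \<open>Up to the scalar \<open>g\<close> this is the \<open>d\<close>-th symmetric power of an
  invertible 2 by 2 matrix. It unites the three standard forms without normalizing the linear
  factors.\<close>

definition mobius_form :: "nat \<Rightarrow> 'a::field mat \<Rightarrow> bool" where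
  "mobius_form d L \<longleftrightarrow> (\<exists>g a0 a1 b0 b1. g \<noteq> 0 \<and> a0 * b1 \<noteq> a1 * b0 \<and>
    (\<forall>i\<le>d. row_poly L i = smult g ([:a0, a1:] ^ i * [:b0, b1:] ^ (d - i))))"

lemma degree_linear_powers_le:
  assumes "i \<le> d"
  shows "degree ([:a0, a1:] ^ i * [:b0, b1:] ^ (d - i)) \<le> d"
  using degree_mult_le[of "[:a0, a1:] ^ i" "[:b0, b1:] ^ (d - i)"]
    degree_linear_power_le[of a0 a1 i] degree_linear_power_le[of b0 b1 "d - i"] assms
  by linarith

lemma standard_form_iff_mobius_form:
  fixes L :: "'a::field mat"
  assumes n: "n \<ge> 1" and L: "L \<in> carrier_mat (2 * n - 1) (2 * n - 1)"
  shows "standard_form n L \<longleftrightarrow> mobius_form (2 * n - 2) L"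
proof -
  define d where "d = 2 * n - 2"
  have m: "2 * n - 1 = Suc d" using n by (simp add: d_def)
  note L' = L[unfolded m]
  have V: "transpose_mat L = \<gamma> \<cdot>\<^sub>m (Vmat (Suc d) \<alpha> * Dmat (Suc d) r) \<longleftrightarrow>
    (\<forall>i\<le>d. row_poly L i = smult (\<gamma> * r ^ i) ([:\<alpha>, 1:] ^ i))" for \<gamma> r \<alpha>
    by (rule transpose_eq_iff_row_poly[OF L'])
      (auto simp: Vmat_eq intro: order_trans[OF degree_linear_power_le])
  have VF: "transpose_mat L = \<gamma> \<cdot>\<^sub>m (Vmat (Suc d) \<alpha> * Fmat (Suc d) * Dmat (Suc d) r) \<longleftrightarrow>
    (\<forall>i\<le>d. row_poly L i = smult (\<gamma> * r ^ i) ([:\<alpha>, 1:] ^ (d - i)))" for \<gamma> r \<alpha>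
  proof (rule transpose_eq_iff_row_poly[OF L'])
    show "Vmat (Suc d) \<alpha> * Fmat (Suc d) \<in> carrier_mat (Suc d) (Suc d)"
      by (intro mult_carrier_mat[of _ _ "Suc d"]) (simp_all add: Vmat_eq Fmat_def)
    show "(Vmat (Suc d) \<alpha> * Fmat (Suc d)) $$ (j, i) = coeff ([:\<alpha>, 1:] ^ (d - i)) j"
      if "i \<le> d" "j \<le> d" for i j
      using that by (subst index_mult_Fmat) (auto simp: Vmat_eq)
  qed (auto intro: order_trans[OF degree_linear_power_le])
  have W: "transpose_mat L = \<gamma> \<cdot>\<^sub>m (Wmat (Suc d) \<alpha> \<beta> * Dmat (Suc d) r) \<longleftrightarrow>
    (\<forall>i\<le>d. row_poly L i = smult (\<gamma> * r ^ i) ([:\<alpha>, 1:] ^ i * [:\<beta>, 1:] ^ (d - i)))" for \<gamma> r \<alpha> \<beta>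
    by (rule transpose_eq_iff_row_poly[OF L']) (auto simp: Wmat_eq degree_linear_powers_le)
  show ?thesis
    unfolding d_def[symmetric]
  proof
    assume "standard_form n L"
    then obtain \<gamma> r \<alpha> \<beta> where nz: "\<gamma> * r \<noteq> 0" "\<alpha> \<noteq> \<beta>" and cases:
      "(\<forall>i\<le>d. row_poly L i = smult (\<gamma> * r ^ i) ([:\<alpha>, 1:] ^ i)) \<or>
       (\<forall>i\<le>d. row_poly L i = smult (\<gamma> * r ^ i) ([:\<alpha>, 1:] ^ (d - i))) \<or>
       (\<forall>i\<le>d. row_poly L i = smult (\<gamma> * r ^ i) ([:\<alpha>, 1:] ^ i * [:\<beta>, 1:] ^ (d - i)))"
      unfolding standard_form_def m V VF W by blast
    \<comment> \<open>The factor \<open>r ^ i\<close> is absorbed by the numerator: the three forms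
      belong to r (x + \<alpha>), r / (x + \<alpha>) and r (x + \<alpha>) / (x + \<beta>).\<close>
    have scale: "smult (\<gamma> * r ^ i) (p ^ i * q) = smult \<gamma> (smult r p ^ i * q)" for p q i
      by (simp add: smult_power)
    from cases show "mobius_form d L"
    proof (elim disjE)
      assume *: "\<forall>i\<le>d. row_poly L i = smult (\<gamma> * r ^ i) ([:\<alpha>, 1:] ^ i)"
      have "\<forall>i\<le>d. row_poly L i = smult \<gamma> ([:r * \<alpha>, r:] ^ i * [:1, 0:] ^ (d - i))"
        using * scale[of _ "[:\<alpha>, 1:]" 1] by (simp add: one_pCons[symmetric])
      moreover have "r * \<alpha> * 0 \<noteq> r * 1" using nz by simp
      ultimately show ?thesis using nz unfolding mobius_form_def by (metis mult_zero_left)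
    next
      assume *: "\<forall>i\<le>d. row_poly L i = smult (\<gamma> * r ^ i) ([:\<alpha>, 1:] ^ (d - i))"
      have "\<forall>i\<le>d. row_poly L i = smult \<gamma> ([:r, 0:] ^ i * [:\<alpha>, 1:] ^ (d - i))"
        using * scale[of _ 1] by (simp add: smult_one)
      moreover have "r * 1 \<noteq> 0 * \<alpha>" using nz by simp
      ultimately show ?thesis using nz unfolding mobius_form_def by (metis mult_zero_left)
    next
      assume *: "\<forall>i\<le>d. row_poly L i =
        smult (\<gamma> * r ^ i) ([:\<alpha>, 1:] ^ i * [:\<beta>, 1:] ^ (d - i))"
      have "\<forall>i\<le>d. row_poly L i = smult \<gamma> ([:r * \<alpha>, r:] ^ i * [:\<beta>, 1:] ^ (d - i))"
        using * scale[of _ "[:\<alpha>, 1:]"] by simp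
      moreover have "r * \<alpha> * 1 \<noteq> r * \<beta>" using nz by simp
      ultimately show ?thesis using nz unfolding mobius_form_def by (metis mult_zero_left)
    qed
  next
    assume "mobius_form d L"
    then obtain g a0 a1 b0 b1 where g: "g \<noteq> 0" and det: "a0 * b1 \<noteq> a1 * b0"
      and row: "\<And>i. i \<le> d \<Longrightarrow> row_poly L i = smult g ([:a0, a1:] ^ i * [:b0, b1:] ^ (d - i))"
      unfolding mobius_form_def by blast
    \<comment> \<open>Conversely numerator and denominator are made monic. The extracted scalars
      give a ^ i * b ^ (d - i) = b ^ d * (a / b) ^ i, hence \<open>\<gamma> = g * b ^ d\<close> and
      \<open>r = a / b\<close> in each case.\<close>
    have factor: "smult g (smult a p ^ i * smult b q ^ (d - i)) =
      smult (g * b ^ d * (a / b) ^ i) (p ^ i * q ^ (d - i))"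
      if "b \<noteq> 0" "i \<le> d" for a b p q i
      using that by (simp add: smult_power power_divide power_diff mult_ac)
    consider "b1 = 0" | "b1 \<noteq> 0" "a1 = 0" | "b1 \<noteq> 0" "a1 \<noteq> 0" by blast
    then show "standard_form n L"
    proof cases
      case 1
      with det have nz: "a1 \<noteq> 0" "b0 \<noteq> 0" by auto
      have eq: "[:a0, a1:] = smult a1 [:a0 / a1, 1:]" "[:b0, b1:] = smult b0 1"
        using nz 1 by auto
      have "row_poly L i = smult (g * b0 ^ d * (a1 / b0) ^ i) ([:a0 / a1, 1:] ^ i)"
        if "i \<le> d" for i
        unfolding row[OF that] eq factor[OF nz(2) that] by simp
      \<comment> \<open>\<open>standard_form\<close> quantifies \<beta> ahead of its alternatives;
        \<open>a0 / a1 + 1\<close> is some value other than \<alpha>.\<close>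
      moreover have "g * b0 ^ d * (a1 / b0) \<noteq> 0" "a0 / a1 \<noteq> a0 / a1 + 1" using g nz by auto
      ultimately show ?thesis unfolding standard_form_def m V VF W by blast
    next
      case 2
      with det have nz: "a0 \<noteq> 0" by auto
      have eq: "[:a0, a1:] = smult a0 1" "[:b0, b1:] = smult b1 [:b0 / b1, 1:]"
        using nz 2 by auto
      have "row_poly L i = smult (g * b1 ^ d * (a0 / b1) ^ i) ([:b0 / b1, 1:] ^ (d - i))"
        if "i \<le> d" for i
        unfolding row[OF that] eq factor[OF 2(1) that] by simp
      moreover have "g * b1 ^ d * (a0 / b1) \<noteq> 0" "b0 / b1 \<noteq> b0 / b1 + 1" using g nz 2 by auto
      ultimately show ?thesis unfolding standard_form_def m V VF W by blast
    next
      case 3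
      have eq: "[:a0, a1:] = smult a1 [:a0 / a1, 1:]" "[:b0, b1:] = smult b1 [:b0 / b1, 1:]"
        using 3 by auto
      have "row_poly L i =
          smult (g * b1 ^ d * (a1 / b1) ^ i) ([:a0 / a1, 1:] ^ i * [:b0 / b1, 1:] ^ (d - i))"
        if "i \<le> d" for i
        unfolding row[OF that] eq factor[OF 3(1) that] ..
      moreover have "g * b1 ^ d * (a1 / b1) \<noteq> 0" "a0 / a1 \<noteq> b0 / b1"
        using g 3 det by (auto simp: field_simps)
      ultimately show ?thesis unfolding standard_form_def m V VF W by blast
    qed
  qed
qed

text \<open>The image of a parameter has as homogeneous coordinates the values of the two linear
  factors, or at infinity their coefficients of degree 1. The nonzero determinant keeps these from
  vanishing together.\<close>

lemma mobius_form_preserves_R: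
  fixes L :: "'a::field mat"
  assumes n: "n \<ge> 1" and L: "L \<in> carrier_mat (2 * n - 1) (2 * n - 1)"
    and "mobius_form (2 * n - 2) L"
  shows "preserves_R n L"
proof -
  define d where "d = 2 * n - 2"
  have m: "2 * n - 1 = Suc d" using n by (simp add: d_def)
  from assms(3) obtain g a0 a1 b0 b1 where g: "g \<noteq> 0" and det: "a0 * b1 \<noteq> a1 * b0"
    and row: "\<And>i. i \<le> d \<Longrightarrow> row_poly L i = smult g ([:a0, a1:] ^ i * [:b0, b1:] ^ (d - i))"
    unfolding mobius_form_def d_def[symmetric] by blast
  have "L *\<^sub>v hvec n \<xi> \<in> Rset n" for \<xi>
  proof (cases \<xi>)
    case None
    have "coeff (row_poly L i) d = g * a1 ^ i * b1 ^ (d - i)" if "i \<le> d" for i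
      using coeff_mult_add[OF degree_linear_power_le[of a0 a1 i] degree_linear_power_le[of b0 b1 "d - i"]]
        that by (simp add: row coeff_linear_power_top mult.assoc)
    then have "L *\<^sub>v hvec n \<xi> = vec (2 * n - 1) (\<lambda>i. g * a1 ^ i * b1 ^ (2 * n - 2 - i))"
      unfolding None mult_mat_hvec_None[OF L n] d_def[symmetric] m by (intro eq_vecI) auto
    moreover have "a1 \<noteq> 0 \<or> b1 \<noteq> 0" using det by auto
    ultimately show ?thesis unfolding mem_Rset_iff[OF n] using g by blast
  next
    case (Some x)
    let ?s = "a0 + x * a1" and ?t = "b0 + x * b1"
    have "L *\<^sub>v hvec n \<xi> = vec (2 * n - 1) (\<lambda>i. g * ?s ^ i * ?t ^ (2 * n - 2 - i))"
      unfolding Some mult_mat_hvec_Some[OF L] d_def[symmetric] m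
      by (intro eq_vecI) (auto simp: row poly_power mult.assoc)
    moreover have "?s \<noteq> 0 \<or> ?t \<noteq> 0"
    proof (rule ccontr)
      assume "\<not> (?s \<noteq> 0 \<or> ?t \<noteq> 0)"
      then have "a0 = - x * a1" "b0 = - x * b1" by (simp_all add: eq_neg_iff_add_eq_0)
      with det show False by simp
    qed
    ultimately show ?thesis unfolding mem_Rset_iff[OF n] using g by blast
  qed
  then show ?thesis using preserves_R_iff_hvec[OF L] by blast
qed

section \<open>Factorization of the row polynomials\<close>

text \<open>
  In terms of the reduced fraction \<open>a / b = P 1 / P 0\<close>, the denominator \<open>b\<close> of
  \<open>P d = P 0 * (a / b) ^ d\<close> must cancel completely.
\<close>

lemma power_progression_factorization:
  fixes P :: "nat \<Rightarrow> 'a::field_gcd poly"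
  assumes d: "d \<ge> 1" and P0: "P 0 \<noteq> 0"
    and P: "\<And>i. 1 \<le> i \<Longrightarrow> i \<le> d \<Longrightarrow> P i * P 0 ^ (i - 1) = P 1 ^ i"
  obtains g a b where "g \<noteq> 0" "b \<noteq> 0" "coprime a b" "\<And>i. i \<le> d \<Longrightarrow> P i = g * a ^ i * b ^ (d - i)"
proof -
  define G where "G = gcd (P 1) (P 0)"
  have G: "G \<noteq> 0" using P0 by (simp add: G_def)
  obtain a b where ab: "P 1 = a * G" "P 0 = b * G" "coprime a b"
    using gcd_coprime_exists[of "P 1" "P 0"] G unfolding G_def by blast
  have b: "b \<noteq> 0" using ab P0 by auto
  \<comment> \<open>This is the hypothesis on \<open>P\<close> with \<open>G ^ (i - 1)\<close>
    cancelled.\<close>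
  have P_G: "P i * b ^ (i - 1) = G * a ^ i" if "1 \<le> i" "i \<le> d" for i
  proof -
    have "G ^ i = G * G ^ (i - 1)" using that by (cases i) auto
    with P[OF that, unfolded ab(1,2)] have "G ^ (i - 1) * (P i * b ^ (i - 1)) = G ^ (i - 1) * (G * a ^ i)"
      by (simp add: power_mult_distrib mult_ac)
    with G show ?thesis by simp
  qed
  \<comment> \<open>The last index carries the highest power of \<open>b\<close>. Being coprime to
    \<open>a ^ d\<close>, it divides \<open>G\<close>, and the quotient is \<open>g\<close>.\<close>
  from P_G[of d] d have "b ^ (d - 1) dvd G * a ^ d" by (metis dvd_triv_right order_refl)
  moreover have "coprime (b ^ (d - 1)) (a ^ d)"
    using ab(3) by (simp add: coprime_commute)
  ultimately have "b ^ (d - 1) dvd G" by (simp add: coprime_dvd_mult_left_iff)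
  then obtain g where g: "G = b ^ (d - 1) * g" by (elim dvdE)
  have "P i = g * a ^ i * b ^ (d - i)" if "i \<le> d" for i
  proof (cases "i = 0")
    case True
    have "b ^ d = b * b ^ (d - 1)" using d by (cases d) auto
    with True ab g show ?thesis by (simp add: mult_ac)
  next
    case False
    with that have "b ^ (d - 1) = b ^ (d - i) * b ^ (i - 1)" by (simp flip: power_add)
    with P_G[of i] False that have "b ^ (i - 1) * P i = b ^ (i - 1) * (g * a ^ i * b ^ (d - i))"
      by (simp add: g mult_ac)
    with b show ?thesis by simp
  qed
  moreover have "g \<noteq> 0" using g G by auto
  ultimately show ?thesis using that b ab(3) by blast
qed

text \<open>Both claims hold at each point because the entries there are c * s ^ j * t ^ (d - j)
  with d = 2 * n - 2; characteristic 0 provides enough points to pass to polynomials. The second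
  claim serves the case without a usable denominator \<open>row_poly L 0\<close>: there c or t
  vanishes at every point.\<close>

lemma preserves_R_row_poly_relation:
  fixes L :: "'a::field_char_0 mat"
  assumes n: "n \<ge> 1" and L: "L \<in> carrier_mat (2 * n - 1) (2 * n - 1)" and R: "preserves_R n L"
    and i: "1 \<le> i" "i \<le> 2 * n - 2"
  shows "row_poly L i * row_poly L 0 ^ (i - 1) = row_poly L 1 ^ i"
    and "row_poly L 0 = 0 \<Longrightarrow> i < 2 * n - 2 \<Longrightarrow> row_poly L i = 0"
proof -
  have ex: "\<exists>c s t. \<forall>j\<le>2 * n - 2. poly (row_poly L j) x = c * s ^ j * t ^ (2 * n - 2 - j)" for x
  proof -
    have "L *\<^sub>v hvec n (Some x) \<in> Rset n" using R preserves_R_iff_hvec[OF L] by blast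
    then obtain c s t where
      *: "vec (2 * n - 1) (\<lambda>i. poly (row_poly L i) x) = vec (2 * n - 1) (\<lambda>i. c * s ^ i * t ^ (2 * n - 2 - i))"
      unfolding mem_Rset_iff[OF n] mult_mat_hvec_Some[OF L] by blast
    have "poly (row_poly L j) x = c * s ^ j * t ^ (2 * n - 2 - j)" if "j \<le> 2 * n - 2" for j
      using arg_cong[OF *, of "\<lambda>v. v $ j"] that n by simp
    then show ?thesis by blast
  qed
  show "row_poly L i * row_poly L 0 ^ (i - 1) = row_poly L 1 ^ i"
  proof -
    have "poly (row_poly L i * row_poly L 0 ^ (i - 1)) x = poly (row_poly L 1 ^ i) x" for x
    proof -
      obtain c s t where p: "\<And>j. j \<le> 2 * n - 2 \<Longrightarrow>
          poly (row_poly L j) x = c * s ^ j * t ^ (2 * n - 2 - j)"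
        using ex[of x] by blast
      \<comment> \<open>With \<open>i = Suc k\<close> and \<open>2 * n - 2 = Suc k + e\<close> no
        subtraction remains in the exponents, and only the powers of \<open>t\<close> have to be
        compared.\<close>
      obtain k where k: "i = Suc k" using i by (cases i) auto
      obtain e where e: "2 * n - 2 = Suc k + e" using i k le_Suc_ex by blast
      have "poly (row_poly L i) x = c * s ^ Suc k * t ^ e"
        "poly (row_poly L 0) x = c * t ^ (Suc k + e)"
        "poly (row_poly L 1) x = c * s * t ^ (k + e)"
        using p[of i] p[of 0] p[of 1] e k by simp_all
      moreover have "t ^ e * (t ^ (Suc k + e)) ^ k = (t ^ (k + e)) ^ Suc k"
      proof -
        have "e + (Suc k + e) * k = (k + e) * Suc k" by (simp add: algebra_simps)
        then show ?thesis by (metis power_add power_mult)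
      qed
      ultimately show ?thesis
        using k by (simp add: poly_power power_mult_distrib mult_ac)
    qed
    then show ?thesis by (simp add: fun_eq_iff flip: poly_eq_poly_eq_iff)
  qed
  show "row_poly L i = 0" if "row_poly L 0 = 0" "i < 2 * n - 2"
  proof -
    have "poly (row_poly L i) x = 0" for x
    proof -
      obtain c s t where p: "\<And>j. j \<le> 2 * n - 2 \<Longrightarrow>
          poly (row_poly L j) x = c * s ^ j * t ^ (2 * n - 2 - j)"
        using ex[of x] by blast
      show ?thesis using p[of 0] p[of i] that by auto
    qed
    then show ?thesis by (simp add: fun_eq_iff flip: poly_eq_poly_eq_iff)
  qed
qed

section \<open>From preservation to Moebius form or rank one\<close>

lemma eq_outer_if_row_polys_proportional:
  fixes L :: "'a::field mat"
  assumes L: "L \<in> carrier_mat (Suc d) (Suc d)" and h: "dim_vec h = Suc d"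
    and p: "degree p \<le> d" and row: "\<And>i. i \<le> d \<Longrightarrow> row_poly L i = smult (h $ i) p"
  shows "L = outer h (vec (Suc d) (coeff p))"
proof (rule eq_matI)
  fix i j assume "i < dim_row (outer h (vec (Suc d) (coeff p)))"
    "j < dim_col (outer h (vec (Suc d) (coeff p)))"
  then have ij: "i \<le> d" "j \<le> d" using h by auto
  then have "L $$ (i, j) = coeff (row_poly L i) j" using L by (simp add: coeff_row_poly)
  with ij h show "L $$ (i, j) = outer h (vec (Suc d) (coeff p)) $$ (i, j)"
    by (simp add: row)
qed (use L h in auto)

text \<open>With determinant 0 a nonconstant one of the two polynomials divides the other and is a
  common nonunit. Two constants must be excluded, since they can be coprime with determinant
  0.\<close>

lemma coprime_linear_det_nonzero:
  fixes a0 a1 b0 b1 :: "'a::field_gcd"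
  assumes cop: "coprime [:a0, a1:] [:b0, b1:]" and nz: "a1 \<noteq> 0 \<or> b1 \<noteq> 0"
  shows "a0 * b1 \<noteq> a1 * b0"
proof
  assume det: "a0 * b1 = a1 * b0"
  have no_unit: False if "q dvd [:a0, a1:]" "q dvd [:b0, b1:]" "degree q > 0" for q
    using coprime_common_divisor[OF cop that(1,2)] that(3) by (auto simp: is_unit_poly_iff)
  show False
  proof (cases "b1 = 0")
    case True
    with det nz have "a1 \<noteq> 0" "b0 = 0" by auto
    with True no_unit[of "[:a0, a1:]"] show False by auto
  next
    case False
    have "[:a0, a1:] = smult (a1 / b1) [:b0, b1:]"
      using False det by (simp add: field_simps)
    then have "[:b0, b1:] dvd [:a0, a1:]" by (metis dvd_refl dvd_smult)
    with False no_unit[of "[:b0, b1:]"] show False by auto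
  qed
qed

lemma degree_le_1E:
  assumes "degree p \<le> 1"
  obtains a b where "p = [:a, b:]"
proof -
  obtain a q where q: "p = pCons a q" by (cases p)
  with assms have "degree q = 0" by (cases "q = 0") auto
  then obtain b where "q = [:b:]" by (elim degree_eq_zeroE)
  with q that show ?thesis by blast
qed

text \<open>For \<open>n = 1\<close> there is no row 1 to form a fraction from. The matrix is a
  scalar, nonzero because 0 is not in \<open>Rset\<close>, and all powers in the Moebius form are
  1.\<close>

lemma preserves_R_1_imp_mobius_form:
  fixes L :: "'a::field mat"
  assumes L: "L \<in> carrier_mat 1 1" and R: "preserves_R 1 L"
  shows "mobius_form 0 L"
proof -
  have L1: "L \<in> carrier_mat (2 * 1 - 1) (2 * 1 - 1)" using L by simp
  have "degree (row_poly L 0) \<le> 0" using degree_row_poly[of L 1 0] L by simp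
  then obtain g where g: "row_poly L 0 = [:g:]" by (auto elim: degree_eq_zeroE)
  have "g \<noteq> 0"
  proof
    assume "g = 0"
    then have "L *\<^sub>v hvec 1 None = 0\<^sub>v (2 * 1 - 1)"
      unfolding mult_mat_hvec_None[OF L1 order_refl] using g by auto
    with zero_not_in_Rset[of 1] R preserves_R_iff_hvec[OF L1] show False by (metis order_refl)
  qed
  then show ?thesis
    unfolding mobius_form_def using g
    by (intro exI[of _ g] exI[of _ 0] exI[of _ 1]) auto
qed

lemma preserves_R_imp_mobius_form_or_outer:
  fixes L :: "'a::{field_char_0, field_gcd} mat"
  assumes n: "n \<ge> 1" and L: "L \<in> carrier_mat (2 * n - 1) (2 * n - 1)" and R: "preserves_R n L"
  shows "mobius_form (2 * n - 2) L \<or>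
    (\<exists>h \<in> Rset n. \<exists>c \<in> carrier_vec (2 * n - 1). L = outer h c)"
proof -
  define d where "d = 2 * n - 2"
  have m: "2 * n - 1 = Suc d" using n by (simp add: d_def)
  note L' = L[unfolded m]
  define P where "P = row_poly L"
  have degP: "degree (P i) \<le> d" for i unfolding P_def by (rule degree_row_poly[OF L'])
  have outerI: ?thesis
    if "h \<in> Rset n" "degree p \<le> d" "\<And>i. i \<le> d \<Longrightarrow> P i = smult (h $ i) p" for h p
    using eq_outer_if_row_polys_proportional[OF L', of h p] dim_Rset[OF that(1)] that
    unfolding m P_def by (metis vec_carrier)
  show ?thesis
  proof (cases "d = 0")
    case True
    then have "n = 1" using n by (simp add: d_def)
    then show ?thesis using preserves_R_1_imp_mobius_form[of L] L R by simp
  next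
    case False
    show ?thesis
    proof (cases "P 0 = 0")
      case True
      have "P i = 0" if "i < d" for i
        using preserves_R_row_poly_relation(2)[OF n L R, of i] that True
        by (cases "i = 0") (auto simp: P_def d_def)
      then have "P i = smult (hvec n None $ i) (P d)" if "i \<le> d" for i
        using that m by (auto simp: hvec_def unit_vec_def d_def[symmetric])
      \<comment> \<open>Only the last row survives, so every image is a multiple of
        \<open>hvec n None\<close>.\<close>
      with outerI hvec_in_Rset degP show ?thesis by blast
    next
      case P0: False
      obtain g a b where g: "g \<noteq> 0" and b: "b \<noteq> 0" and cop: "coprime a b"
        and P: "\<And>i. i \<le> d \<Longrightarrow> P i = g * a ^ i * b ^ (d - i)"
      proof (rule power_progression_factorization[of d P])
        show "P i * P 0 ^ (i - 1) = P 1 ^ i" if "1 \<le> i" "i \<le> d" for i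
          using preserves_R_row_poly_relation(1)[OF n L R, of i] that by (simp add: P_def d_def)
      qed (use False P0 in auto)
      have degb: "degree g + d * degree b \<le> d"
        using degP[of 0] P[of 0] g b by (simp add: degree_mult_eq degree_power_eq)
      \<comment> \<open>If \<open>a = 0\<close>, then \<open>P d\<close> vanishes and tells nothing
        about \<open>g\<close>; the bound then follows from \<open>degb\<close>.\<close>
      have dega: "degree g + d * degree a \<le> d"
        using degP[of d] P[of d] g degb
        by (cases "a = 0") (auto simp: degree_mult_eq degree_power_eq)
      have "k \<le> 1" if "degree g + d * k \<le> d" for k
      proof -
        from that have "d * k \<le> d * 1" by linarith
        with False show ?thesis by simp
      qed
      with dega degb have le1: "degree a \<le> 1" "degree b \<le> 1" by blast+
      obtain a0 a1 where a: "a = [:a0, a1:]" using le1(1) by (rule degree_le_1E)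
      obtain b0 b1 where b': "b = [:b0, b1:]" using le1(2) by (rule degree_le_1E)
      show ?thesis
      proof (cases "a1 = 0 \<and> b1 = 0")
        case True
        have const: "[:c:] ^ k = [:c ^ k:]" for c :: 'a and k by (induction k) auto
        have b0: "b0 \<noteq> 0" using b b' True by auto
        \<comment> \<open>The fixed image point has homogeneous coordinates (a0 : b0); the factor 1
          matches the shape in \<open>mem_Rset_iff\<close>.\<close>
        let ?h = "vec (2 * n - 1) (\<lambda>i. 1 * a0 ^ i * b0 ^ (2 * n - 2 - i))"
        have "?h \<in> Rset n" unfolding mem_Rset_iff[OF n] using b0 by (metis zero_neq_one)
        moreover have "degree g \<le> d" using degb by simp
        moreover have "P i = smult (?h $ i) g" if "i \<le> d" for i
          using that True unfolding m d_def[symmetric]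
          by (simp add: P a b' const mult_ac)
        ultimately show ?thesis by (rule outerI)
      next
        case nc: False
        then have "a0 * b1 \<noteq> a1 * b0"
          using coprime_linear_det_nonzero cop a b' by blast
        \<comment> \<open>A linear factor to the power \<open>d\<close> already exhausts the degree
          bound.\<close>
        moreover have "degree g = 0"
          using nc dega degb a b' by (auto split: if_splits)
        then obtain k where k: "g = [:k:]" by (elim degree_eq_zeroE)
        then have "P i = smult k ([:a0, a1:] ^ i * [:b0, b1:] ^ (d - i))" if "i \<le> d" for i
          using P[OF that] a b' by simp
        moreover have "k \<noteq> 0" using g k by auto
        ultimately have "mobius_form d L" unfolding mobius_form_def P_def by blast
        then show ?thesis by (simp add: d_def)
      qed
    qed
  qed
qed

section \<open>The characterization over the real and the complex numbers\<close>

text \<open>One statement for both fields: \<open>field_gcd\<close> supplies reduced fractions of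
  polynomials, \<open>field_char_0\<close> infinitely many points. The conditions on
  \<open>c\<close> come from \<open>preserves_R_outer_iff\<close>.\<close>

lemma preserves_R_iff:
  fixes L :: "'a::{field_char_0, field_gcd} mat"
  assumes n: "n \<ge> 1" and L: "L \<in> carrier_mat (2 * n - 1) (2 * n - 1)"
  shows "preserves_R n L \<longleftrightarrow> standard_form n L \<or>
    (\<exists>h \<in> Rset n. \<exists>c \<in> carrier_vec (2 * n - 1). L = outer h c \<and>
      (\<forall>x. (\<Sum>i<2 * n - 1. c $ i * x ^ i) \<noteq> 0) \<and> c $ (2 * n - 2) \<noteq> 0)"
  using preserves_R_imp_mobius_form_or_outer[OF n L] mobius_form_preserves_R[OF n L]
    preserves_R_outer_iff[OF n]
  unfolding standard_form_iff_mobius_form[OF n L] by blast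

text \<open>By the fundamental theorem of algebra a polynomial without roots is constant, while
  \<open>c d\<close> is its coefficient of degree \<open>d\<close>.\<close>

lemma complex_coeffs_no_root:
  fixes c :: "nat \<Rightarrow> complex"
  assumes "\<forall>x. (\<Sum>i\<le>d. c i * x ^ i) \<noteq> 0" and "c d \<noteq> 0"
  shows "d = 0"
proof -
  define p where "p = (\<Sum>i\<le>d. monom (c i) i)"
  have "poly p x \<noteq> 0" for x using assms(1) by (simp add: p_def poly_sum poly_monom)
  then have "degree p = 0"
    using fundamental_theorem_of_algebra[of p] by (auto simp: constant_degree)
  moreover have "coeff p d \<noteq> 0" using assms(2) by (simp add: p_def coeff_sum)
  ultimately show ?thesis using le_degree by fastforce
qed

lemma preserves_R_complex_iff:
  fixes L :: "complex mat"
  assumes n: "n \<ge> 1" and L: "L \<in> carrier_mat (2 * n - 1) (2 * n - 1)"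
  shows "preserves_R n L \<longleftrightarrow> standard_form n L"
proof
  assume R: "preserves_R n L"
  show "standard_form n L"
  proof (rule ccontr)
    assume "\<not> standard_form n L"
    with R obtain h c where h: "h \<in> Rset n" and Lhc: "L = outer h c" and c: "c \<in> carrier_vec (2 * n - 1)"
      and nz: "\<forall>x. (\<Sum>i<2 * n - 1. c $ i * x ^ i) \<noteq> 0" "c $ (2 * n - 2) \<noteq> 0"
      using preserves_R_iff[OF n L] by blast
    have m: "2 * n - 1 = Suc (2 * n - 2)" using n by simp
    have "2 * n - 2 = 0"
      using complex_coeffs_no_root[of "\<lambda>i. c $ i" "2 * n - 2"] nz
      unfolding m lessThan_Suc_atMost by blast
    then have n1: "n = 1" using n by simp
    \<comment> \<open>The rank-one case survives only for 1 by 1 matrices, and these are of Moebius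
      form as well.\<close>
    have "mobius_form (2 * n - 2) L"
      using preserves_R_1_imp_mobius_form[of L] L R n1 by simp
    with \<open>\<not> standard_form n L\<close> show False using standard_form_iff_mobius_form[OF n L] by blast
  qed
qed (use preserves_R_iff[OF n L] in blast)

theorem theorem3p5:
  fixes n :: nat
  assumes "n \<ge> 1"
  shows "(\<forall>L :: real mat. L \<in> carrier_mat (2 * n - 1) (2 * n - 1) \<longrightarrow>
            (preserves_R n L \<longleftrightarrow>
               standard_form n L \<or>
               (\<exists>h \<in> Rset n. \<exists>c \<in> carrier_vec (2 * n - 1).
                  L = outer h c \<and>
                  (\<forall>x::real. (\<Sum>i<2 * n - 1. c $ i * x ^ i) \<noteq> 0) \<and> c $ (2 * n - 2) \<noteq> 0))) \<and>
         (\<forall>L :: complex mat. L \<in> carrier_mat (2 * n - 1) (2 * n - 1) \<longrightarrow>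
            (preserves_R n L \<longleftrightarrow> standard_form n L))"
  by (intro conjI allI impI preserves_R_iff preserves_R_complex_iff assms)

end
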